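(* Let $M$ be an ordered $\Gamma$-groupoid and let $\mu : M \to [0,1]$ be a fuzzy subset of $M$. (i) If $\mu$ is a fuzzy semiprime ideal of $M$ and $t\in[0,1]$ is such that $\mu_t \neq \emptyset$, then $\mu_t$ is a semiprime ideal of $M$. (ii) Conversely, if $\mu_t$ is a semiprime ideal of $M$ for every $t\in[0,1]$, then $\mu$ is a fuzzy semiprime ideal of $M$.
   Context: Let $M,\Gamma$ be nonempty sets. $M$ is a $\Gamma$-groupoid if there is a well-defined operation $M\times\Gamma\times M\to M$, $(a,\gamma,b)\mapsto a\gamma b$ (no associativity assumed). An ordered $\Gamma$-groupoid is a $\Gamma$-groupoid $M$ with a partial order $\le$ on $M$ such that $a\le b$ implies $a\gamma c\le b\gamma c$ and $c\gamma a\le c\gamma b$ for all $c\in M$, $\gamma\in\Gamma$. A nonempty subset $A\subseteq M$ is a left (resp. right) ideal of $M$ if (1) $x\gamma a\in A$ (resp. $a\gamma x\in A$) for all $x\in M,\gamma\in\Gamma,a\in A$, and (2) $a\in A$, $b\in M$, $b\le a$ imply $b\in A$. It is an ideal if it is both a left and a right ideal. (In particular ideals are nonempty by definition.) A subset $T\subseteq M$ is semiprime if for all $a\in M$, $\gamma\in\Gamma$, $a\gamma a\in T$ implies $a\in T$. A semiprime ideal is an ideal which is a semiprime subset. A fuzzy subset of $M$ is any mapping $\mu:M\to[0,1]$. It is a fuzzy left (resp. right) ideal of $M$ if (1) $\mu(x\gamma y)\ge\mu(y)$ (resp. $\mu(x\gamma y)\ge\mu(x)$) for all $x,y\in M$,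 $\gamma\in\Gamma$, and (2) $x\le y$ implies $\mu(x)\ge\mu(y)$. It is a fuzzy ideal if it is both a fuzzy left and a fuzzy right ideal. It is a fuzzy semiprime subset if $\mu(x)\ge\mu(x\gamma x)$ for all $x\in M$, $\gamma\in\Gamma$. A fuzzy semiprime ideal is a fuzzy ideal which is a fuzzy semiprime subset. For $t\in[0,1]$, the level subset is $\mu_t:=\{x\in M\mid \mu(x)\ge t\}$. *)

theory Defs
  imports Complex_Main "HOL-Library.FuncSet"
begin

text \<open>\<open>M\<close> and \<open>\<Gamma>\<close> are carrier sets; the operation \<open>op a \<gamma> b\<close> stands for
  \<open>a \<gamma> b\<close>, and \<open>a \<le> b\<close> is \<open>(a, b) \<in> r\<close>.\<close>

locale gamma_groupoid =
  fixes M :: "'m set" and \<Gamma> :: "'g set" and op :: "'m \<Rightarrow> 'g \<Rightarrow> 'm \<Rightarrow> 'm"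
  assumes carrier_nonempty: "M \<noteq> {}"
    and gamma_nonempty: "\<Gamma> \<noteq> {}"
    and op_closed: "\<lbrakk>a \<in> M; \<gamma> \<in> \<Gamma>; b \<in> M\<rbrakk> \<Longrightarrow> op a \<gamma> b \<in> M"

locale ordered_gamma_groupoid = gamma_groupoid M \<Gamma> op
  for M :: "'m set" and \<Gamma> :: "'g set" and op :: "'m \<Rightarrow> 'g \<Rightarrow> 'm \<Rightarrow> 'm" +
  fixes r :: "('m \<times> 'm) set"
  assumes partial_order: "partial_order_on M r"
    and op_mono_left:
      "\<lbrakk>a \<in> M; b \<in> M; c \<in> M; \<gamma> \<in> \<Gamma>; (a, b) \<in> r\<rbrakk> \<Longrightarrow> (op a \<gamma> c, op b \<gamma> c) \<in> r"
    and op_mono_right: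
      "\<lbrakk>a \<in> M; b \<in> M; c \<in> M; \<gamma> \<in> \<Gamma>; (a, b) \<in> r\<rbrakk> \<Longrightarrow> (op c \<gamma> a, op c \<gamma> b) \<in> r"

definition left_ideal ::
    "'m set \<Rightarrow> 'g set \<Rightarrow> ('m \<Rightarrow> 'g \<Rightarrow> 'm \<Rightarrow> 'm) \<Rightarrow> ('m \<times> 'm) set \<Rightarrow> 'm set \<Rightarrow> bool" where
  "left_ideal M \<Gamma> op r A \<longleftrightarrow>
     A \<noteq> {} \<and> A \<subseteq> M \<and>
     (\<forall>x\<in>M. \<forall>\<gamma>\<in>\<Gamma>. \<forall>a\<in>A. op x \<gamma> a \<in> A) \<and>
     (\<forall>a\<in>A. \<forall>b\<in>M. (b, a) \<in> r \<longrightarrow> b \<in> A)"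

definition right_ideal ::
    "'m set \<Rightarrow> 'g set \<Rightarrow> ('m \<Rightarrow> 'g \<Rightarrow> 'm \<Rightarrow> 'm) \<Rightarrow> ('m \<times> 'm) set \<Rightarrow> 'm set \<Rightarrow> bool" where
  "right_ideal M \<Gamma> op r A \<longleftrightarrow>
     A \<noteq> {} \<and> A \<subseteq> M \<and>
     (\<forall>x\<in>M. \<forall>\<gamma>\<in>\<Gamma>. \<forall>a\<in>A. op a \<gamma> x \<in> A) \<and>
     (\<forall>a\<in>A. \<forall>b\<in>M. (b, a) \<in> r \<longrightarrow> b \<in> A)"

definition gamma_ideal ::
    "'m set \<Rightarrow> 'g set \<Rightarrow> ('m \<Rightarrow> 'g \<Rightarrow> 'm \<Rightarrow> 'm) \<Rightarrow> ('m \<times> 'm) set \<Rightarrow> 'm set \<Rightarrow> bool" where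
  "gamma_ideal M \<Gamma> op r A \<longleftrightarrow> left_ideal M \<Gamma> op r A \<and> right_ideal M \<Gamma> op r A"

definition semiprime_subset ::
    "'m set \<Rightarrow> 'g set \<Rightarrow> ('m \<Rightarrow> 'g \<Rightarrow> 'm \<Rightarrow> 'm) \<Rightarrow> 'm set \<Rightarrow> bool" where
  "semiprime_subset M \<Gamma> op T \<longleftrightarrow>
     T \<subseteq> M \<and> (\<forall>a\<in>M. \<forall>\<gamma>\<in>\<Gamma>. op a \<gamma> a \<in> T \<longrightarrow> a \<in> T)"

definition semiprime_ideal ::
    "'m set \<Rightarrow> 'g set \<Rightarrow> ('m \<Rightarrow> 'g \<Rightarrow> 'm \<Rightarrow> 'm) \<Rightarrow> ('m \<times> 'm) set \<Rightarrow> 'm set \<Rightarrow> bool" where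
  "semiprime_ideal M \<Gamma> op r A \<longleftrightarrow> gamma_ideal M \<Gamma> op r A \<and> semiprime_subset M \<Gamma> op A"

text \<open>A map \<open>M \<rightarrow> [0,1]\<close> is represented by a total function of which only the values
  on \<open>M\<close> are constrained and used.\<close>

definition fuzzy_subset :: "'m set \<Rightarrow> ('m \<Rightarrow> real) \<Rightarrow> bool" where
  "fuzzy_subset M \<mu> \<longleftrightarrow> \<mu> \<in> M \<rightarrow> {0..1}"

definition fuzzy_left_ideal ::
    "'m set \<Rightarrow> 'g set \<Rightarrow> ('m \<Rightarrow> 'g \<Rightarrow> 'm \<Rightarrow> 'm) \<Rightarrow> ('m \<times> 'm) set \<Rightarrow> ('m \<Rightarrow> real) \<Rightarrow> bool" where
  "fuzzy_left_ideal M \<Gamma> op r \<mu> \<longleftrightarrow>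
     fuzzy_subset M \<mu> \<and>
     (\<forall>x\<in>M. \<forall>y\<in>M. \<forall>\<gamma>\<in>\<Gamma>. \<mu> (op x \<gamma> y) \<ge> \<mu> y) \<and>
     (\<forall>x\<in>M. \<forall>y\<in>M. (x, y) \<in> r \<longrightarrow> \<mu> x \<ge> \<mu> y)"

definition fuzzy_right_ideal ::
    "'m set \<Rightarrow> 'g set \<Rightarrow> ('m \<Rightarrow> 'g \<Rightarrow> 'm \<Rightarrow> 'm) \<Rightarrow> ('m \<times> 'm) set \<Rightarrow> ('m \<Rightarrow> real) \<Rightarrow> bool" where
  "fuzzy_right_ideal M \<Gamma> op r \<mu> \<longleftrightarrow>
     fuzzy_subset M \<mu> \<and>
     (\<forall>x\<in>M. \<forall>y\<in>M. \<forall>\<gamma>\<in>\<Gamma>. \<mu> (op x \<gamma> y) \<ge> \<mu> x) \<and>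
     (\<forall>x\<in>M. \<forall>y\<in>M. (x, y) \<in> r \<longrightarrow> \<mu> x \<ge> \<mu> y)"

definition fuzzy_ideal ::
    "'m set \<Rightarrow> 'g set \<Rightarrow> ('m \<Rightarrow> 'g \<Rightarrow> 'm \<Rightarrow> 'm) \<Rightarrow> ('m \<times> 'm) set \<Rightarrow> ('m \<Rightarrow> real) \<Rightarrow> bool" where
  "fuzzy_ideal M \<Gamma> op r \<mu> \<longleftrightarrow> fuzzy_left_ideal M \<Gamma> op r \<mu> \<and> fuzzy_right_ideal M \<Gamma> op r \<mu>"

definition fuzzy_semiprime_subset ::
    "'m set \<Rightarrow> 'g set \<Rightarrow> ('m \<Rightarrow> 'g \<Rightarrow> 'm \<Rightarrow> 'm) \<Rightarrow> ('m \<Rightarrow> real) \<Rightarrow> bool" where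
  "fuzzy_semiprime_subset M \<Gamma> op \<mu> \<longleftrightarrow>
     fuzzy_subset M \<mu> \<and> (\<forall>x\<in>M. \<forall>\<gamma>\<in>\<Gamma>. \<mu> x \<ge> \<mu> (op x \<gamma> x))"

definition fuzzy_semiprime_ideal ::
    "'m set \<Rightarrow> 'g set \<Rightarrow> ('m \<Rightarrow> 'g \<Rightarrow> 'm \<Rightarrow> 'm) \<Rightarrow> ('m \<times> 'm) set \<Rightarrow> ('m \<Rightarrow> real) \<Rightarrow> bool" where
  "fuzzy_semiprime_ideal M \<Gamma> op r \<mu> \<longleftrightarrow>
     fuzzy_ideal M \<Gamma> op r \<mu> \<and> fuzzy_semiprime_subset M \<Gamma> op \<mu>"

definition level_subset :: "'m set \<Rightarrow> ('m \<Rightarrow> real) \<Rightarrow> real \<Rightarrow> 'm set" where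
  "level_subset M \<mu> t = {x \<in> M. \<mu> x \<ge> t}"

end

theory Submission
  imports Defs
begin

text \<open>Each fuzzy condition is an inequality \<mu> u \<le> \<mu> v for certain related points
  u, v of M, and its crisp counterpart says that u \<in> A implies v \<in> A. An inequality \<mu> u
  \<le> \<mu> v means exactly that every level subset containing u also contains v. One direction,
  \<open>semiprime_ideal_level_subset\<close>, is transitivity: t \<le> \<mu> u \<le> \<mu> v. The
  other, \<open>fuzzy_semiprime_ideal_if_level_subsets\<close>, takes the threshold t = \<mu> u,
  whose level contains u and hence v.\<close>

lemma semiprime_ideal_level_subset:
  assumes "gamma_groupoid M \<Gamma> op" and "fuzzy_semiprime_ideal M \<Gamma> op r \<mu>"
    and "level_subset M \<mu> t \<noteq> {}"
  shows "semiprime_ideal M \<Gamma> op r (level_subset M \<mu> t)"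
proof -
  let ?L = "level_subset M \<mu> t"
  note closed = gamma_groupoid.op_closed[OF assms(1)]
  have left: "\<And>x y \<gamma>. \<lbrakk>x \<in> M; y \<in> M; \<gamma> \<in> \<Gamma>\<rbrakk> \<Longrightarrow> \<mu> y \<le> \<mu> (op x \<gamma> y)"
    and right: "\<And>x y \<gamma>. \<lbrakk>x \<in> M; y \<in> M; \<gamma> \<in> \<Gamma>\<rbrakk> \<Longrightarrow> \<mu> x \<le> \<mu> (op x \<gamma> y)"
    and anti: "\<And>x y. \<lbrakk>x \<in> M; y \<in> M; (x, y) \<in> r\<rbrakk> \<Longrightarrow> \<mu> y \<le> \<mu> x"
    and semi: "\<And>x \<gamma>. \<lbrakk>x \<in> M; \<gamma> \<in> \<Gamma>\<rbrakk> \<Longrightarrow> \<mu> (op x \<gamma> x) \<le> \<mu> x"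
    using assms(2)
    unfolding fuzzy_semiprime_ideal_def fuzzy_ideal_def fuzzy_left_ideal_def
      fuzzy_right_ideal_def fuzzy_semiprime_subset_def
    by simp_all
  \<comment> \<open>Each closure property chains t \<le> \<mu> a with one of the inequalities above;
    \<open>closed\<close> keeps the products inside M, as membership in the level also
    demands.\<close>
  have "left_ideal M \<Gamma> op r ?L" "right_ideal M \<Gamma> op r ?L"
    using assms(3) unfolding left_ideal_def right_ideal_def level_subset_def
    by (auto intro: closed order_trans[OF _ left] order_trans[OF _ right] order_trans[OF _ anti])
  moreover have "semiprime_subset M \<Gamma> op ?L"
    unfolding semiprime_subset_def level_subset_def by (auto intro: order_trans[OF _ semi])
  ultimately show ?thesis
    unfolding semiprime_ideal_def gamma_ideal_def by blast
qed

text \<open>The thresholds are the values of \<mu>: the level at \<mu> z is the smallest one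
  containing z, so membership of x in it is precisely the inequality \<mu> z \<le> \<mu> x to be
  proved.\<close>

lemma fuzzy_semiprime_ideal_if_level_subsets:
  assumes "gamma_groupoid M \<Gamma> op" and fuzzy: "fuzzy_subset M \<mu>"
    and levels: "\<forall>z\<in>M. semiprime_ideal M \<Gamma> op r (level_subset M \<mu> (\<mu> z))"
  shows "fuzzy_semiprime_ideal M \<Gamma> op r \<mu>"
proof -
  note closed = gamma_groupoid.op_closed[OF assms(1)]
  let ?L = "\<lambda>z. level_subset M \<mu> (\<mu> z)"
  have self: "z \<in> ?L z" if "z \<in> M" for z
    using that by (simp add: level_subset_def)
  have le: "\<mu> z \<le> \<mu> x" if "x \<in> ?L z" for x z
    using that by (simp add: level_subset_def)
  have left: "\<mu> y \<le> \<mu> (op x \<gamma> y)" and right: "\<mu> x \<le> \<mu> (op x \<gamma> y)"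
    if "x \<in> M" "y \<in> M" "\<gamma> \<in> \<Gamma>" for x y \<gamma>
  proof -
    have "op x \<gamma> y \<in> ?L y"
      using levels that self
      unfolding semiprime_ideal_def gamma_ideal_def left_ideal_def by blast
    then show "\<mu> y \<le> \<mu> (op x \<gamma> y)" by (rule le)
    have "op x \<gamma> y \<in> ?L x"
      using levels that self
      unfolding semiprime_ideal_def gamma_ideal_def right_ideal_def by blast
    then show "\<mu> x \<le> \<mu> (op x \<gamma> y)" by (rule le)
  qed
  have anti: "\<mu> y \<le> \<mu> x" if "x \<in> M" "y \<in> M" "(x, y) \<in> r" for x y
  proof (rule le)
    \<comment> \<open>The level at \<mu> y contains y and is closed downwards.\<close>
    show "x \<in> ?L y"
      using levels that self
      unfolding semiprime_ideal_def gamma_ideal_def left_ideal_def by blast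
  qed
  have semi: "\<mu> (op x \<gamma> x) \<le> \<mu> x" if "x \<in> M" "\<gamma> \<in> \<Gamma>" for x \<gamma>
  proof (rule le)
    \<comment> \<open>Here the threshold is the value at the square, so the square must be a point
      of M before it can index a level; semiprimeness then passes from the square to x.\<close>
    have "op x \<gamma> x \<in> M"
      using that by (simp add: closed)
    then show "x \<in> ?L (op x \<gamma> x)"
      using levels that self unfolding semiprime_ideal_def semiprime_subset_def by blast
  qed
  show ?thesis
    using fuzzy left right anti semi
    unfolding fuzzy_semiprime_ideal_def fuzzy_ideal_def fuzzy_left_ideal_def
      fuzzy_right_ideal_def fuzzy_semiprime_subset_def
    by simp
qed

theorem theorem10:
  fixes M :: "'m set" and \<Gamma> :: "'g set" and op :: "'m \<Rightarrow> 'g \<Rightarrow> 'm \<Rightarrow> 'm"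
    and r :: "('m \<times> 'm) set" and \<mu> :: "'m \<Rightarrow> real"
  assumes "ordered_gamma_groupoid M \<Gamma> op r"
    and "fuzzy_subset M \<mu>"
  shows "(fuzzy_semiprime_ideal M \<Gamma> op r \<mu> \<longrightarrow>
            (\<forall>t\<in>{0..1}. level_subset M \<mu> t \<noteq> {} \<longrightarrow>
               semiprime_ideal M \<Gamma> op r (level_subset M \<mu> t))) \<and>
         ((\<forall>t\<in>{0..1}. semiprime_ideal M \<Gamma> op r (level_subset M \<mu> t)) \<longrightarrow>
            fuzzy_semiprime_ideal M \<Gamma> op r \<mu>)"
proof -
  have groupoid: "gamma_groupoid M \<Gamma> op"
    using assms(1) by (rule ordered_gamma_groupoid.axioms)
  \<comment> \<open>This makes t = \<mu> z an admissible threshold in the hypothesis of the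
    converse.\<close>
  have "\<mu> z \<in> {0..1}" if "z \<in> M" for z
    using assms(2) that unfolding fuzzy_subset_def by (rule funcset_mem)
  then show ?thesis
    using semiprime_ideal_level_subset[OF groupoid]
      fuzzy_semiprime_ideal_if_level_subsets[OF groupoid assms(2)]
    by blast
qed

end
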